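(* Let $B_c>0$, $W_{1,m},W_{2,m}>0$, $\Gamma_{1,m},\Gamma_{2,m}>0$. Suppose that $\Gamma_{1,m}\ge\Gamma_{2,m}$, $1<W_{2,m}/W_{1,m}<\Gamma_{1,m}/\Gamma_{2,m}$ and $q_m>2\Omega_m$, with $$\Omega_m=\frac{W_{2,m}\Gamma_{2,m}-W_{1,m}\Gamma_{1,m}}{\Gamma_{1,m}\Gamma_{2,m}(W_{1,m}-W_{2,m})}.$$ Then the optimal solution of the problem $$\max_{p_{1,m},p_{2,m}}\ W_{1,m}R_{1,m}+W_{2,m}R_{2,m}\quad\text{s.t.}\quad 0\le p_{1,m}\le p_{2,m},\ \ p_{1,m}+p_{2,m}=q_m,$$ where $R_{1,m}=B_c\log(1+p_{1,m}\Gamma_{1,m})$ and $R_{2,m}=B_c\log\left(1+\frac{p_{2,m}\Gamma_{2,m}}{p_{1,m}\Gamma_{2,m}+1}\right)$, is given by $p_{1,m}^\star=\Omega_m$ and $p_{2,m}^\star=q_m-p_{1,m}^\star$.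
   Context: Setting: downlink two-user NOMA on a channel $m$ of bandwidth $B_c$; $\Gamma_{l,m}$ is the channel-to-noise ratio of user $l$, $p_{l,m}$ its power, $R_{l,m}$ its rate, $W_{l,m}$ its weight, $q_m$ the power budget of the channel. $\log$ is the base-2 logarithm. *)

theory Defs
  imports Complex_Main
begin

text \<open>
  All quantities refer to one fixed channel, so the channel index is dropped.
  User 1 cancels the signal of user 2 before decoding, while user 2 treats the signal
  of user 1 as interference; hence the first power occurs in the denominator of the
  second rate. Logarithms are to base 2.
\<close>

definition rate1 :: "real \<Rightarrow> real \<Rightarrow> real \<Rightarrow> real" where
  "rate1 Bc \<Gamma>1 p1 = Bc * log 2 (1 + p1 * \<Gamma>1)"

definition rate2 :: "real \<Rightarrow> real \<Rightarrow> real \<Rightarrow> real \<Rightarrow> real" where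
  "rate2 Bc \<Gamma>2 p1 p2 = Bc * log 2 (1 + p2 * \<Gamma>2 / (p1 * \<Gamma>2 + 1))"

definition weighted_sum_rate ::
  "real \<Rightarrow> real \<Rightarrow> real \<Rightarrow> real \<Rightarrow> real \<Rightarrow> real \<times> real \<Rightarrow> real" where
  "weighted_sum_rate Bc W1 W2 \<Gamma>1 \<Gamma>2 =
     (\<lambda>(p1, p2). W1 * rate1 Bc \<Gamma>1 p1 + W2 * rate2 Bc \<Gamma>2 p1 p2)"

definition feasible_power :: "real \<Rightarrow> real \<times> real \<Rightarrow> bool" where
  "feasible_power q = (\<lambda>(p1, p2). 0 \<le> p1 \<and> p1 \<le> p2 \<and> p1 + p2 = q)"

definition Omega :: "real \<Rightarrow> real \<Rightarrow> real \<Rightarrow> real \<Rightarrow> real" where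
  "Omega W1 W2 \<Gamma>1 \<Gamma>2 = (W2 * \<Gamma>2 - W1 * \<Gamma>1) / (\<Gamma>1 * \<Gamma>2 * (W1 - W2))"

end

theory Submission
  imports Defs
begin

text \<open>
  On the feasible line the objective is, up to a constant and the factor \<open>Bc / ln 2\<close>,
  \<open>f p = W1 ln (1 + p \<Gamma>1) - W2 ln (1 + p \<Gamma>2)\<close>, which is not concave. Put
  \<open>r = W1 / W2 < 1\<close> and \<open>1 + s = (1 + p \<Gamma>1) / (1 + \<Omega> \<Gamma>1)\<close>. Since \<open>\<Omega>\<close> is the critical point of \<open>f\<close>,
  \<open>(1 + p \<Gamma>2) / (1 + \<Omega> \<Gamma>2) = 1 + r s\<close>, so that \<open>f p < f \<Omega>\<close> for \<open>p \<noteq> \<Omega>\<close> is the strict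
  Bernoulli inequality \<open>(1 + s) powr r < 1 + r s\<close>.
\<close>

lemma ln_less_minus_one:
  fixes x :: real
  assumes "x > 0" "x \<noteq> 1"
  shows "ln x < x - 1"
  using ln_le_minus_one[of x] ln_eq_minus_one[of x] assms by linarith

text \<open>Strict concavity of \<open>ln\<close>: \<open>1 + r * s\<close> is the mean of
  \<open>1 + s\<close> and \<open>1\<close> with weights \<open>r\<close> and
  \<open>1 - r\<close>.\<close>

lemma ln_Bernoulli_strict:
  fixes r s :: real
  assumes r: "0 < r" "r < 1" and s: "s > -1" "s \<noteq> 0"
  shows "r * ln (1 + s) < ln (1 + r * s)"
proof -
  define y where "y = 1 + r * s"
  have y: "y > 0"
  proof -
    have "r * (-1) < r * s" using r s by (intro mult_strict_left_mono) auto
    then show ?thesis using r by (simp add: y_def)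
  qed
  have "(1 + s) / y > 0" using y s by simp
  moreover have "(1 + s) / y \<noteq> 1" using y r s by (auto simp: y_def)
  ultimately have 1: "ln ((1 + s) / y) < (1 + s) / y - 1" by (rule ln_less_minus_one)
  have 2: "ln (1 / y) \<le> 1 / y - 1" using y by (intro ln_le_minus_one) auto
  \<comment> \<open>Tangent bounds of \<open>ln\<close> at \<open>y\<close>, taken at
    \<open>1 + s\<close> and at \<open>1\<close>; averaged, their linear parts cancel. The first is
    strict since \<open>1 + s \<noteq> y\<close>.\<close>
  have "r * ln ((1 + s) / y) + (1 - r) * ln (1 / y)
      < r * ((1 + s) / y - 1) + (1 - r) * (1 / y - 1)"
    using 1 2 r by (intro add_less_le_mono mult_strict_left_mono mult_left_mono) auto
  also have "\<dots> = 0" using y by (simp add: field_simps y_def)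
  finally have "r * (ln (1 + s) - ln y) - (1 - r) * ln y < 0"
    using y s by (simp add: ln_div)
  then show ?thesis by (simp add: y_def algebra_simps)
qed

text \<open>The assumption \<open>critical\<close> is the vanishing of the derivative at
  \<open>w\<close>, cleared of denominators.\<close>

lemma weighted_log_difference_less:
  fixes W1 W2 a b c d :: real
  assumes W: "0 < W1" "W1 < W2" and \<open>0 \<le> w\<close> \<open>0 \<le> p\<close> \<open>p \<noteq> w\<close> \<open>0 < a\<close> \<open>0 < b\<close>
    and critical: "W1 * a * (1 + w * b) = W2 * b * (1 + w * a)"
  shows "W1 * ln (1 + p * a) - W2 * ln (1 + p * b)
       < W1 * ln (1 + w * a) - W2 * ln (1 + w * b)"
proof -
  define A where "A = 1 + w * a"
  define B where "B = 1 + w * b"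
  define s where "s = (p - w) * a / A"
  have pos: "A > 0" "B > 0" "1 + p * a > 0" "1 + p * b > 0"
    using assms by (simp_all add: A_def B_def add_pos_nonneg)
  have s1: "1 + s = (1 + p * a) / A"
    using pos by (simp add: s_def field_simps) (simp add: A_def algebra_simps)
  \<comment> \<open>Expanding by \<open>B\<close> exposes the left side of \<open>critical\<close>;
    after its replacement by \<open>W2 * b * A\<close>, the factor \<open>W2 * A\<close>
    cancels.\<close>
  have "W1 / W2 * s = (p - w) * (W1 * a * B) / (W2 * A * B)"
    using pos by (simp add: s_def)
  also have "\<dots> = (p - w) * b / B"
    using critical W pos by (simp add: A_def[symmetric] B_def[symmetric])
  finally have s2: "1 + W1 / W2 * s = (1 + p * b) / B"
    using pos by (simp add: field_simps) (simp add: B_def algebra_simps)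
  have "1 + s > 0" unfolding s1 using pos by simp
  moreover have "s \<noteq> 0" using assms pos by (simp add: s_def)
  ultimately have "W1 / W2 * ln (1 + s) < ln (1 + W1 / W2 * s)"
    using W by (intro ln_Bernoulli_strict) auto
  then have "W1 * (ln (1 + p * a) - ln A) < W2 * (ln (1 + p * b) - ln B)"
    using W pos unfolding s1 s2 by (simp add: ln_div field_simps)
  then show ?thesis by (simp add: A_def B_def algebra_simps)
qed

lemma Omega_critical:
  assumes "W1 < W2" "0 < \<Gamma>1" "0 < \<Gamma>2"
  defines "w \<equiv> Omega W1 W2 \<Gamma>1 \<Gamma>2"
  shows "W1 * \<Gamma>1 * (1 + w * \<Gamma>2) = W2 * \<Gamma>2 * (1 + w * \<Gamma>1)"
proof -
  have "w * (\<Gamma>1 * \<Gamma>2 * (W1 - W2)) = W2 * \<Gamma>2 - W1 * \<Gamma>1"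
    using assms by (simp add: Omega_def)
  then show ?thesis by (simp add: algebra_simps)
qed

text \<open>With total power \<open>q\<close>, signal plus interference plus noise of user 2 is
  \<open>1 + q * \<Gamma>2\<close> for every split, so its rate is a constant minus a log term in
  \<open>p\<close>.\<close>

lemma weighted_sum_rate_on_budget:
  assumes "0 \<le> p" "p \<le> q" "0 < \<Gamma>2"
  shows "weighted_sum_rate Bc W1 W2 \<Gamma>1 \<Gamma>2 (p, q - p)
       = Bc / ln 2 * (W1 * ln (1 + p * \<Gamma>1) - W2 * ln (1 + p * \<Gamma>2) + W2 * ln (1 + q * \<Gamma>2))"
proof -
  have pos: "1 + p * \<Gamma>2 > 0" "1 + q * \<Gamma>2 > 0"
    using assms by (simp_all add: add_pos_nonneg)
  have "1 + (q - p) * \<Gamma>2 / (p * \<Gamma>2 + 1) = (1 + q * \<Gamma>2) / (1 + p * \<Gamma>2)"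
    using pos by (simp add: field_simps)
  then show ?thesis
    using pos
    by (simp add: weighted_sum_rate_def rate1_def rate2_def log_def ln_div field_simps)
qed

lemma is_arg_max_unique_iff:
  fixes f :: "'a \<Rightarrow> 'b::order"
  assumes "P z" "\<And>x. P x \<Longrightarrow> x \<noteq> z \<Longrightarrow> f x < f z"
  shows "is_arg_max f P x \<longleftrightarrow> x = z"
  using assms unfolding is_arg_max_def by (metis less_asym less_irrefl)

theorem proposition2:
  fixes Bc W1 W2 \<Gamma>1 \<Gamma>2 q :: real
  assumes "Bc > 0"
    and "W1 > 0" and "W2 > 0"
    and "\<Gamma>1 > 0" and "\<Gamma>2 > 0"
    and "\<Gamma>1 \<ge> \<Gamma>2"
    and "1 < W2 / W1" and "W2 / W1 < \<Gamma>1 / \<Gamma>2"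
    and "q > 2 * Omega W1 W2 \<Gamma>1 \<Gamma>2"
  shows "\<forall>p1 p2.
    is_arg_max (weighted_sum_rate Bc W1 W2 \<Gamma>1 \<Gamma>2) (feasible_power q) (p1, p2) \<longleftrightarrow>
      p1 = Omega W1 W2 \<Gamma>1 \<Gamma>2 \<and> p2 = q - p1"
proof -
  define w where "w = Omega W1 W2 \<Gamma>1 \<Gamma>2"
  let ?f = "weighted_sum_rate Bc W1 W2 \<Gamma>1 \<Gamma>2"
  have W: "W1 < W2" using assms by (simp add: field_simps)
  have "W2 * \<Gamma>2 < W1 * \<Gamma>1" using assms by (simp add: field_simps)
  \<comment> \<open>Numerator and denominator of \<open>Omega\<close> are both negative. The second
    bound yields \<open>w \<le> q - w\<close>, the power order required for feasibility.\<close>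
  then have w: "0 < w" "2 * w < q"
    using W assms by (auto simp: w_def Omega_def intro!: divide_neg_neg mult_pos_neg)
  have "?f x < ?f (w, q - w)" if x: "feasible_power q x" "x \<noteq> (w, q - w)" for x
  proof -
    obtain p where p: "x = (p, q - p)" "0 \<le> p" "p \<le> q - p"
      using x(1) by (cases x) (auto simp: feasible_power_def)
    have "W1 * ln (1 + p * \<Gamma>1) - W2 * ln (1 + p * \<Gamma>2)
        < W1 * ln (1 + w * \<Gamma>1) - W2 * ln (1 + w * \<Gamma>2)"
      using W w p x(2) assms Omega_critical[of W1 W2 \<Gamma>1 \<Gamma>2]
      by (intro weighted_log_difference_less) (auto simp: w_def)
    moreover have "p \<le> q" "w \<le> q" using p w by auto
    ultimately show ?thesis
      using p w assms
      by (simp add: weighted_sum_rate_on_budget mult_strict_left_mono divide_strict_right_mono)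
  qed
  moreover have "feasible_power q (w, q - w)" using w by (simp add: feasible_power_def)
  ultimately have "is_arg_max ?f (feasible_power q) x \<longleftrightarrow> x = (w, q - w)" for x
    by (intro is_arg_max_unique_iff)
  then show ?thesis by (auto simp: w_def)
qed

end
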